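(* There is an absolute constant $C>0$ such that for all $n\ge 2$, the number of labelled $n$-vertex bipartite graphs that are intersection graphs of $x$-monotone curves in the plane is at most $2^{C n\log^2 n}$.
   Context: A curve is a subset of the plane $\mathbb{R}^2$ homeomorphic to the interval $[0,1]$. A curve is $x$-monotone if every vertical line intersects it in at most one point. Two curves are allowed to intersect any number of times. A labelled $n$-vertex intersection graph of $x$-monotone curves is a graph $G$ on the vertex set $\{1,\dots,n\}$ for which there is a collection $\gamma_1,\dots,\gamma_n$ of $x$-monotone curves such that distinct $i,j$ are adjacent in $G$ if and only if $\gamma_i\cap\gamma_j\neq\emptyset$. Labelled graphs are counted as distinct if their edge sets differ. *)

theory Defs
  imports "HOL-Analysis.Analysis"
begin

definition is_curve :: "(real \<times> real) set \<Rightarrow> bool" where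
  "is_curve S \<longleftrightarrow> S homeomorphic {0..1::real}"

definition vertical_line :: "real \<Rightarrow> (real \<times> real) set" where
  "vertical_line a = {p. fst p = a}"

definition x_monotone :: "(real \<times> real) set \<Rightarrow> bool" where
  "x_monotone S \<longleftrightarrow> (\<forall>a. \<exists>\<^sub>\<le>\<^sub>1 p. p \<in> S \<inter> vertical_line a)"

text \<open>
  A labelled graph on a vertex set is identified with its edge set, a set of two-element
  subsets of the vertex set.
\<close>

definition labelled_graph :: "'a set \<Rightarrow> 'a set set \<Rightarrow> bool" where
  "labelled_graph V E \<longleftrightarrow> (\<forall>e\<in>E. e \<subseteq> V \<and> card e = 2)"

definition bipartite :: "'a set \<Rightarrow> 'a set set \<Rightarrow> bool" where
  "bipartite V E \<longleftrightarrow>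
     (\<exists>A B. A \<union> B = V \<and> A \<inter> B = {} \<and> (\<forall>e\<in>E. \<exists>a\<in>A. \<exists>b\<in>B. e = {a, b}))"

definition x_monotone_intersection_graph :: "nat \<Rightarrow> nat set set \<Rightarrow> bool" where
  "x_monotone_intersection_graph n E \<longleftrightarrow>
     labelled_graph {1..n} E \<and>
     (\<exists>\<gamma>. (\<forall>i\<in>{1..n}. is_curve (\<gamma> i) \<and> x_monotone (\<gamma> i)) \<and>
          (\<forall>i\<in>{1..n}. \<forall>j\<in>{1..n}. i \<noteq> j \<longrightarrow> ({i, j} \<in> E \<longleftrightarrow> \<gamma> i \<inter> \<gamma> j \<noteq> {})))"

definition bipartite_x_monotone_graphs :: "nat \<Rightarrow> nat set set set" where
  "bipartite_x_monotone_graphs n =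
     {E. x_monotone_intersection_graph n E \<and> bipartite {1..n} E}"

text \<open>Finiteness makes the cardinality of this set an honest count.\<close>

lemma finite_bipartite_x_monotone_graphs: "finite (bipartite_x_monotone_graphs n)"
proof (rule finite_subset)
  show "bipartite_x_monotone_graphs n \<subseteq> Pow (Pow {1..n})"
    by (auto simp: bipartite_x_monotone_graphs_def x_monotone_intersection_graph_def
        labelled_graph_def)
qed simp

end

theory Submission
  imports Defs
begin

text \<open>
  An \<open>x\<close>-monotone curve is the graph of a continuous function \<open>f i\<close> on a compact interval
  \<open>{a i..b i}\<close>. In a bipartite intersection graph the curves of one colour class are pairwise
  disjoint. Consider a vertical slab, that is, an interval \<open>I\<close> of abscissae. The curves of one
  colour that span \<open>I\<close> are linearly ordered from bottom to top over \<open>I\<close>, by the intermediate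
  value theorem. A curve \<open>j\<close> of the other colour, spanning or not, is connected over \<open>I\<close>, so the
  spanning curves that it meets there are consecutive in this order: they are those which are
  neither entirely below \<open>j\<close> nor entirely above it. Hence two numbers at most \<open>n\<close> stored with \<open>j\<close>
  (how many spanning curves are below it, how many are not above it), and one number stored with
  each spanning curve (its rank), decide all these incidences; this is \<open>meets_in_slab_iff\<close>.

  It remains to choose \<open>O(log n)\<close> slabs for each curve such that every incidence is seen in a slab
  chosen for both curves. The endpoints of the projections divide the line into linearly many
  atoms, and the slabs are the dyadic blocks of consecutive atoms. If two curves meet above a point,
  then among the blocks around this point take the largest that at least one of the two curves
  covers. Neither curve covers its parent, so for each curve the block or its sibling contains an
  endpoint atom of that curve. Thus on every level only four blocks matter for a curve, and these are
  computable from its endpoint atoms; see \<open>uncovered_parent_imp_nearby\<close> and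
  \<open>common_nearby_block\<close>.

  A curve is therefore encoded by its colour, its two endpoint atoms, and \<open>O(log n)\<close> numbers
  at most \<open>n\<close>. The codes of all \<open>n\<close> curves determine the graph, and there are
  \<open>(n ^ O(log n)) ^ n\<close> of them.
\<close>

section \<open>Curves as graphs of continuous functions\<close>

text \<open>
  The first projection is injective on the compact curve, hence a homeomorphism onto its image,
  which is a compact connected set of reals.
\<close>

lemma x_monotone_curve_is_graph:
  assumes "is_curve S" "x_monotone S"
  obtains a b :: real and f where "continuous_on {a..b} f" "S = (\<lambda>x. (x, f x)) ` {a..b}"
proof -
  have hom: "S homeomorphic {0..1::real}"
    using assms(1) by (simp add: is_curve_def)
  have "compact S"
    using homeomorphic_compactness[OF hom] by simp
  have "connected S"
    using homeomorphic_connectedness[OF hom] by simp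
  have "compact (fst ` S)" "connected (fst ` S)"
    using \<open>compact S\<close> \<open>connected S\<close>
    by (auto intro!: compact_continuous_image connected_continuous_image continuous_intros)
  then obtain a b where ab: "fst ` S = {a..b}"
    by (metis connected_compact_interval_1 box_real(2))
  have inj: "inj_on fst S"
    using assms(2) by (fastforce simp: x_monotone_def inj_on_def Uniq_def vertical_line_def)
  define g where "g = inv_into S fst"
  have "continuous_on (fst ` S) g"
    unfolding g_def using \<open>compact S\<close> inj
    by (intro continuous_on_inv continuous_intros) auto
  then have "continuous_on {a..b} (\<lambda>x. snd (g x))"
    unfolding ab by (intro continuous_intros)
  moreover have "S = (\<lambda>x. (x, snd (g x))) ` {a..b}"
  proof -
    have "(\<lambda>x. (x, snd (g x))) ` fst ` S = id ` S"
      unfolding image_image by (intro image_cong) (auto simp: g_def inv_into_f_f[OF inj])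
    then show ?thesis by (simp add: ab)
  qed
  ultimately show ?thesis using that by blast
qed

section \<open>Spanning curves of a slab\<close>

lemma continuous_no_meet_imp_ordered:
  fixes g h :: "real \<Rightarrow> real"
  assumes "is_interval J" "continuous_on J g" "continuous_on J h" "\<And>x. x \<in> J \<Longrightarrow> g x \<noteq> h x"
  shows "(\<forall>x\<in>J. g x < h x) \<or> (\<forall>x\<in>J. h x < g x)"
proof (rule ccontr)
  assume "\<not> ?thesis"
  then obtain x y where xy: "x \<in> J" "y \<in> J" "g x \<ge> h x" "h y \<ge> g y"
    by (auto simp: not_less)
  have "connected ((\<lambda>x. g x - h x) ` J)"
    using assms by (intro connected_continuous_image continuous_intros) (auto simp: is_interval_connected_1)
  then have "is_interval ((\<lambda>x. g x - h x) ` J)"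
    by (simp add: is_interval_connected_1)
  then have "0 \<in> (\<lambda>x. g x - h x) ` J"
    by (rule mem_is_interval_1_I[where a = "g y - h y" and c = "g x - h x"]) (use xy in auto)
  then show False using assms(4) by auto
qed

text \<open>
  An initial segment of a finite linear order is determined by its size. The order on \<open>K\<close> is given
  by an injective height function.
\<close>

lemma down_closed_iff_rank_less_card:
  fixes g :: "'v \<Rightarrow> real"
  assumes "finite K" "inj_on g K" "D \<subseteq> K" "i \<in> K"
    and down: "\<And>u v. u \<in> K \<Longrightarrow> v \<in> D \<Longrightarrow> g u < g v \<Longrightarrow> u \<in> D"
  shows "i \<in> D \<longleftrightarrow> card {u \<in> K. g u < g i} < card D"
proof
  assume "i \<in> D"
  then have "{u \<in> K. g u < g i} \<subset> D"
    using down by blast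
  then show "card {u \<in> K. g u < g i} < card D"
    using assms finite_subset psubset_card_mono by metis
next
  assume *: "card {u \<in> K. g u < g i} < card D"
  show "i \<in> D"
  proof (rule ccontr)
    assume "i \<notin> D"
    have "D \<subseteq> {u \<in> K. g u < g i}"
    proof
      fix u assume "u \<in> D"
      then have "u \<in> K" "u \<noteq> i" using \<open>i \<notin> D\<close> assms(3) by auto
      then have "g u \<noteq> g i" using assms(2,4) by (auto dest: inj_onD)
      moreover have "\<not> g i < g u" using down[OF assms(4) \<open>u \<in> D\<close>] \<open>i \<notin> D\<close> by blast
      ultimately show "u \<in> {u \<in> K. g u < g i}" using \<open>u \<in> K\<close> by auto
    qed
    then have "card D \<le> card {u \<in> K. g u < g i}"
      using assms(1) by (intro card_mono) auto
    with * show False by simp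
  qed
qed

text \<open>
  The graph of \<open>f i\<close> over \<open>{a i..b i}\<close> is the curve of the vertex \<open>i\<close>. Curves of different colours
  may cross arbitrarily often.
\<close>

locale two_coloured_graphs =
  fixes V :: "'v set" and a b :: "'v \<Rightarrow> real" and f :: "'v \<Rightarrow> real \<Rightarrow> real" and colour :: "'v \<Rightarrow> bool"
  assumes finite_V: "finite V"
    and cont: "i \<in> V \<Longrightarrow> continuous_on {a i..b i} (f i)"
    and disjoint: "\<lbrakk>i \<in> V; j \<in> V; i \<noteq> j; colour i = colour j; x \<in> {a i..b i}; x \<in> {a j..b j}\<rbrakk> \<Longrightarrow> f i x \<noteq> f j x"
begin

definition spanning :: "real set \<Rightarrow> bool \<Rightarrow> 'v set" where
  "spanning I c = {i \<in> V. colour i = c \<and> I \<subseteq> {a i..b i}}"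

text \<open>
  Heights are compared over all of \<open>I\<close>, so that no reference point has to be chosen. The curve \<open>j\<close>
  in the two counts below may cover only a part of \<open>I\<close> or none of it. In the latter case no spanning
  curve counts as not above \<open>j\<close>, and the condition in \<open>meets_in_slab_iff\<close> is false, as it should be.
\<close>

definition slab_rank :: "real set \<Rightarrow> 'v \<Rightarrow> nat" where
  "slab_rank I i = card {u \<in> spanning I (colour i). \<forall>x\<in>I. f u x < f i x}"

definition count_below :: "real set \<Rightarrow> 'v \<Rightarrow> nat" where
  "count_below I j = card {u \<in> spanning I (\<not> colour j). \<forall>x \<in> I \<inter> {a j..b j}. f u x < f j x}"

definition count_not_above :: "real set \<Rightarrow> 'v \<Rightarrow> nat" where
  "count_not_above I j = card {u \<in> spanning I (\<not> colour j). \<exists>x \<in> I \<inter> {a j..b j}. f u x \<le> f j x}"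

lemma finite_spanning: "finite (spanning I c)"
  using finite_V by (simp add: spanning_def)

lemma slab_counts_le:
  "slab_rank I i \<le> card V" "count_below I i \<le> card V" "count_not_above I i \<le> card V"
  unfolding slab_rank_def count_below_def count_not_above_def
  by (intro card_mono finite_V; auto simp: spanning_def)+

lemma spanning_below_at_point_iff:
  assumes "is_interval I" "x \<in> I" "i \<in> spanning I c" "j \<in> spanning I c"
  shows "(\<forall>y\<in>I. f i y < f j y) \<longleftrightarrow> f i x < f j x"
proof (cases "i = j")
  case False
  have "(\<forall>y\<in>I. f i y < f j y) \<or> (\<forall>y\<in>I. f j y < f i y)"
  proof (rule continuous_no_meet_imp_ordered[OF assms(1)])
    show "continuous_on I (f i)" "continuous_on I (f j)"
      using assms(3,4) cont by (auto simp: spanning_def intro: continuous_on_subset)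
    show "f i y \<noteq> f j y" if "y \<in> I" for y
    proof -
      have "y \<in> {a i..b i}" "y \<in> {a j..b j}"
        using assms(3,4) that unfolding spanning_def by blast+
      then show ?thesis using disjoint[of i j y] False assms(3,4) by (simp add: spanning_def)
    qed
  qed
  then show ?thesis using assms(2) by (meson less_asym)
qed (use assms in auto)

text \<open>
  Over the part \<open>J\<close> of \<open>I\<close> that lies in the domain of \<open>j\<close>, the curve \<open>i\<close> misses \<open>j\<close> exactly if it is
  entirely below or entirely above \<open>j\<close>. The spanning curves that are entirely below \<open>j\<close>, and those
  that are not entirely above \<open>j\<close>, form initial segments of the vertical order, so membership of
  \<open>i\<close> in them is a comparison of its rank with their sizes.
\<close>

lemma meets_in_slab_iff:
  assumes I: "is_interval I" and i: "i \<in> V" "I \<subseteq> {a i..b i}" and j: "j \<in> V" "colour i \<noteq> colour j"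
  shows "(\<exists>x \<in> I \<inter> {a j..b j}. f i x = f j x) \<longleftrightarrow>
    count_below I j \<le> slab_rank I i \<and> slab_rank I i < count_not_above I j"
proof (cases "I \<inter> {a j..b j} = {}")
  case True
  then show ?thesis by (simp add: count_not_above_def)
next
  case False
  define J where "J = I \<inter> {a j..b j}"
  from False obtain x where x: "x \<in> J" "x \<in> I" unfolding J_def by blast
  have J: "is_interval J" "J \<subseteq> I" "J \<subseteq> {a j..b j}"
    using I by (auto simp: J_def intro: is_interval_Int is_interval_cc)
  define K where "K = spanning I (colour i)"
  have K: "spanning I (\<not> colour j) = K" "i \<in> K" "finite K"
    using i j finite_spanning by (auto simp: K_def spanning_def)
  have below: "(\<forall>y\<in>I. f u y < f v y) \<longleftrightarrow> f u x < f v x" if "u \<in> K" "v \<in> K" for u v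
    using spanning_below_at_point_iff[OF I x(2)] that by (simp add: K_def)
  have inj: "inj_on (\<lambda>u. f u x) K"
    using disjoint x(2) by (fastforce simp: inj_on_def K_def spanning_def)
  have rank: "slab_rank I i = card {u \<in> K. f u x < f i x}"
    unfolding slab_rank_def K_def[symmetric] using below K(2) by (intro arg_cong[where f = card]) auto
  let ?B = "{u \<in> K. \<forall>y\<in>J. f u y < f j y}" and ?A = "{u \<in> K. \<exists>y\<in>J. f u y \<le> f j y}"
  have "i \<in> ?B \<longleftrightarrow> card {u \<in> K. f u x < f i x} < card ?B"
  proof (rule down_closed_iff_rank_less_card[OF K(3) inj _ K(2)])
    fix u v assume "u \<in> K" "v \<in> ?B" "f u x < f v x"
    then show "u \<in> ?B" using below[of u v] J(2) by (force intro: less_trans)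
  qed auto
  moreover have "i \<in> ?A \<longleftrightarrow> card {u \<in> K. f u x < f i x} < card ?A"
  proof (rule down_closed_iff_rank_less_card[OF K(3) inj _ K(2)])
    fix u v assume "u \<in> K" "v \<in> ?A" "f u x < f v x"
    then show "u \<in> ?A" using below[of u v] J(2) by (force intro: less_imp_le less_le_trans)
  qed auto
  moreover have "(\<exists>y\<in>J. f i y = f j y) \<longleftrightarrow> i \<notin> ?B \<and> i \<in> ?A"
  proof
    assume "i \<notin> ?B \<and> i \<in> ?A"
    moreover have "continuous_on J (f i)" "continuous_on J (f j)"
      using cont i j J by (blast intro: continuous_on_subset)+
    ultimately show "\<exists>y\<in>J. f i y = f j y"
      using continuous_no_meet_imp_ordered[OF J(1), of "f i" "f j"] K(2) by force
  next
    assume "\<exists>y\<in>J. f i y = f j y"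
    then obtain y where "y \<in> J" "\<not> f i y < f j y" "f i y \<le> f j y" by auto
    then show "i \<notin> ?B \<and> i \<in> ?A" using K(2) by blast
  qed
  ultimately show ?thesis
    using rank K(1) by (auto simp: count_below_def count_not_above_def J_def not_less)
qed

end

section \<open>Dyadic blocks\<close>

text \<open>
  The block \<open>k\<close> on level \<open>s\<close> consists of the numbers \<open>y\<close> with \<open>y div 2 ^ s = k\<close>; its parent is the
  block \<open>k div 2\<close> on level \<open>s + 1\<close>.
\<close>

definition covers_block :: "nat \<Rightarrow> nat \<Rightarrow> nat \<Rightarrow> nat \<Rightarrow> bool" where
  "covers_block p q s k \<longleftrightarrow> (\<forall>y. y div 2 ^ s = k \<longrightarrow> p \<le> y \<and> y \<le> q)"

text \<open>
  The blocks of the two endpoints, each with its neighbour towards the inside of the interval. These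
  always have exactly four entries, possibly with repetitions, so that an index below \<open>4\<close> can name
  the block in a code; truncated subtraction at block \<open>0\<close> only produces such a repetition.
\<close>

definition nearby_blocks :: "nat \<Rightarrow> nat \<Rightarrow> nat \<Rightarrow> nat list" where
  "nearby_blocks p q s = [p div 2 ^ s, Suc (p div 2 ^ s), q div 2 ^ s, q div 2 ^ s - 1]"

text \<open>
  The interval from \<open>p\<close> to \<open>q\<close> contains \<open>z\<close> but not all of the parent block of \<open>z\<close>, so one of its
  endpoints lies in that parent. The parent has only two children, so the block of this endpoint is
  the block of \<open>z\<close> or its sibling.
\<close>

lemma uncovered_parent_imp_nearby:
  assumes "p \<le> z" "z \<le> q" "\<not> covers_block p q (Suc s) (z div 2 ^ Suc s)"
  shows "z div 2 ^ s \<in> set (nearby_blocks p q s)"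
proof -
  obtain y where y: "y div 2 ^ Suc s = z div 2 ^ Suc s" "y < p \<or> q < y"
    using assms(3) by (auto simp: covers_block_def not_le)
  have half: "y div 2 ^ s div 2 = z div 2 ^ s div 2"
    using y(1) by (simp only: power_Suc2 div_mult2_eq)
  show ?thesis
  proof (cases "y < p")
    case True
    then have "y div 2 ^ s \<le> p div 2 ^ s" "p div 2 ^ s \<le> z div 2 ^ s"
      using assms(1) by (auto intro: div_le_mono)
    with half have "z div 2 ^ s = p div 2 ^ s \<or> z div 2 ^ s = Suc (p div 2 ^ s)" by linarith
    then show ?thesis by (auto simp: nearby_blocks_def)
  next
    case False
    then have "q div 2 ^ s \<le> y div 2 ^ s" "z div 2 ^ s \<le> q div 2 ^ s"
      using assms(2) y(2) by (auto intro: div_le_mono)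
    with half have "z div 2 ^ s = q div 2 ^ s \<or> z div 2 ^ s = q div 2 ^ s - 1" by linarith
    then show ?thesis by (auto simp: nearby_blocks_def)
  qed
qed

text \<open>
  On level \<open>0\<close> the block of \<open>z\<close> is \<open>{z}\<close>, which both intervals cover; on level \<open>h\<close> it is too large for
  both of them. Going up, there is a last level on which one of the intervals still covers the block.
\<close>

lemma common_nearby_block:
  assumes "p \<le> z" "z \<le> q" "p' \<le> z" "z \<le> q'" and small: "Suc q < 2 ^ h" "Suc q' < 2 ^ h"
  obtains s where "s < h" "z div 2 ^ s \<in> set (nearby_blocks p q s)" "z div 2 ^ s \<in> set (nearby_blocks p' q' s)"
    "covers_block p q s (z div 2 ^ s) \<or> covers_block p' q' s (z div 2 ^ s)"
proof -
  define P where "P s \<longleftrightarrow> \<not> covers_block p q s (z div 2 ^ s) \<and> \<not> covers_block p' q' s (z div 2 ^ s)" for s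
  have top: "\<not> covers_block p q h (z div 2 ^ h)" if "z \<le> q" "Suc q < 2 ^ h" for p q
  proof -
    have "(2 ^ h - 1) div 2 ^ h = z div 2 ^ h" "q < 2 ^ h - 1" using that by auto
    then show ?thesis by (metis covers_block_def not_le)
  qed
  have "\<not> P 0" using assms by (auto simp: P_def covers_block_def)
  moreover have "P h" using top assms by (auto simp: P_def)
  ultimately obtain s where s: "s < h" "\<not> P s" "P (Suc s)"
    using ex_least_nat_less[of P h] by blast
  then show ?thesis
    using that[of s] uncovered_parent_imp_nearby assms unfolding P_def by blast
qed

text \<open>
  This numbers, from left to right, the points of \<open>T\<close> and the open gaps between them. Points and
  gaps get different numbers, so that a closed interval with endpoints in \<open>T\<close> is exactly a range of
  atoms. This matters when one domain ends where another begins: the two domains share an atom, but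
  no gap.
\<close>

definition atom :: "real set \<Rightarrow> real \<Rightarrow> nat" where
  "atom T x = card {t \<in> T. t < x} + card {t \<in> T. t \<le> x}"

lemma atom_mono:
  assumes "finite T" "x \<le> y"
  shows "atom T x \<le> atom T y"
  unfolding atom_def using assms by (intro add_mono card_mono) auto

lemma atom_less:
  assumes "finite T" "x < y" "x \<in> T \<or> y \<in> T"
  shows "atom T x < atom T y"
proof -
  have "card {t \<in> T. t < x} \<le> card {t \<in> T. t < y}" "card {t \<in> T. t \<le> x} \<le> card {t \<in> T. t \<le> y}"
    using assms by (auto intro!: card_mono)
  moreover have "card {t \<in> T. t < x} < card {t \<in> T. t < y}" if "x \<in> T"
    using that assms by (intro psubset_card_mono) auto
  moreover have "card {t \<in> T. t \<le> x} < card {t \<in> T. t \<le> y}" if "y \<in> T"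
  proof (intro psubset_card_mono psubsetI)
    show "{t \<in> T. t \<le> x} \<noteq> {t \<in> T. t \<le> y}"
      using that assms(2) by (metis (mono_tags) mem_Collect_eq not_le order_refl)
  qed (use assms in auto)
  ultimately show ?thesis using assms(3) unfolding atom_def by linarith
qed

lemma atom_le:
  assumes "finite T"
  shows "atom T x \<le> 2 * card T"
proof -
  have "card {t \<in> T. t < x} \<le> card T" "card {t \<in> T. t \<le> x} \<le> card T"
    using assms by (auto intro!: card_mono)
  then show ?thesis by (simp add: atom_def)
qed

lemma is_interval_atom_block: "finite T \<Longrightarrow> is_interval {x. atom T x div m = k}"
  unfolding is_interval_1 by (auto intro!: antisym) (metis atom_mono div_le_mono order.antisym)+

section \<open>Codes\<close>

text \<open>
  The components are the colour, the atoms of the two endpoints, and for the level \<open>s\<close> and the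
  \<open>e\<close>-th nearby block the rank in the slab, the count of curves below, and the count of curves not
  above. The number \<open>4 * n\<close> bounds the atoms of \<open>2 * n\<close> endpoints.
\<close>

type_synonym vertex_code = "bool \<times> nat \<times> nat \<times> (nat \<times> nat \<Rightarrow> nat \<times> nat \<times> nat)"

definition vertex_codes :: "nat \<Rightarrow> nat \<Rightarrow> vertex_code set" where
  "vertex_codes n h = UNIV \<times> {..4 * n} \<times> {..4 * n} \<times>
     (({..<h} \<times> {..<4}) \<rightarrow>\<^sub>E ({..n} \<times> {..n} \<times> {..n}))"

text \<open>
  This decides whether the two curves meet in a slab that is chosen for both of them and that the
  first one spans.
\<close>

fun code_crosses :: "nat \<Rightarrow> vertex_code \<Rightarrow> vertex_code \<Rightarrow> bool" where
  "code_crosses h (c, p, q, d) (c', p', q', d') \<longleftrightarrow> c \<noteq> c' \<and>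
     (\<exists>s<h. \<exists>e<4. \<exists>e'<4. nearby_blocks p q s ! e = nearby_blocks p' q' s ! e' \<and>
        covers_block p q s (nearby_blocks p q s ! e) \<and>
        fst (snd (d' (s, e'))) \<le> fst (d (s, e)) \<and> fst (d (s, e)) < snd (snd (d' (s, e'))))"

context two_coloured_graphs
begin

definition endpoints :: "real set" where
  "endpoints = a ` V \<union> b ` V"

definition slab :: "nat \<Rightarrow> nat \<Rightarrow> real set" where
  "slab s k = {x. atom endpoints x div 2 ^ s = k}"

abbreviation "lo i \<equiv> atom endpoints (a i)"
abbreviation "hi i \<equiv> atom endpoints (b i)"

definition encode :: "nat \<Rightarrow> 'v \<Rightarrow> vertex_code" where
  "encode h i = (colour i, lo i, hi i,
     \<lambda>(s, e) \<in> {..<h} \<times> {..<4}. let I = slab s (nearby_blocks (lo i) (hi i) s ! e) in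
        (slab_rank I i, count_below I i, count_not_above I i))"

lemma finite_endpoints: "finite endpoints"
  using finite_V by (simp add: endpoints_def)

lemma card_endpoints: "card endpoints \<le> 2 * card V"
  unfolding endpoints_def
  using card_Un_le[of "a ` V" "b ` V"] card_image_le[OF finite_V, of a] card_image_le[OF finite_V, of b]
  by linarith

lemma endpoint_atom_le: "atom endpoints x \<le> 4 * card V"
  using atom_le[OF finite_endpoints, of x] card_endpoints by linarith

lemma mem_interval_iff_atom:
  assumes "i \<in> V"
  shows "x \<in> {a i..b i} \<longleftrightarrow> lo i \<le> atom endpoints x \<and> atom endpoints x \<le> hi i"
proof -
  have "a i \<in> endpoints" "b i \<in> endpoints" using assms by (auto simp: endpoints_def)
  then show ?thesis
    using atom_mono[OF finite_endpoints] atom_less[OF finite_endpoints] by (metis atLeastAtMost_iff not_le)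
qed

lemma encode_in_vertex_codes: "encode h i \<in> vertex_codes (card V) h"
  using slab_counts_le endpoint_atom_le
  by (auto simp: encode_def vertex_codes_def PiE_iff Let_def)

lemma slab_subset_if_covers_block:
  "\<lbrakk>i \<in> V; covers_block (lo i) (hi i) s k\<rbrakk> \<Longrightarrow> slab s k \<subseteq> {a i..b i}"
  using mem_interval_iff_atom by (auto simp: slab_def covers_block_def)

lemma code_crosses_encode:
  assumes "i \<in> V" "j \<in> V"
  shows "code_crosses h (encode h i) (encode h j) \<longleftrightarrow> colour i \<noteq> colour j \<and>
    (\<exists>s<h. \<exists>k \<in> set (nearby_blocks (lo i) (hi i) s) \<inter> set (nearby_blocks (lo j) (hi j) s).
       covers_block (lo i) (hi i) s k \<and> (\<exists>x \<in> slab s k \<inter> {a j..b j}. f i x = f j x))"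
proof (cases "colour i = colour j")
  case False
  have len: "length (nearby_blocks p q s) = 4" for p q s by (simp add: nearby_blocks_def)
  have meets: "(\<exists>x \<in> slab s k \<inter> {a j..b j}. f i x = f j x) \<longleftrightarrow>
      count_below (slab s k) j \<le> slab_rank (slab s k) i \<and> slab_rank (slab s k) i < count_not_above (slab s k) j"
    if "covers_block (lo i) (hi i) s k" for s k
    using meets_in_slab_iff[OF _ assms(1) slab_subset_if_covers_block[OF assms(1) that] assms(2) False]
      is_interval_atom_block[OF finite_endpoints] by (simp add: slab_def)
  let ?A = "nearby_blocks (lo i) (hi i)" and ?B = "nearby_blocks (lo j) (hi j)"
  let ?meets = "\<lambda>s k. \<exists>x \<in> slab s k \<inter> {a j..b j}. f i x = f j x"
  have "code_crosses h (encode h i) (encode h j) \<longleftrightarrow>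
      (\<exists>s<h. \<exists>e<4. \<exists>e'<4. ?A s ! e = ?B s ! e' \<and> covers_block (lo i) (hi i) s (?A s ! e) \<and> ?meets s (?A s ! e))"
    using False by (simp add: encode_def Let_def meets cong: conj_cong)
  also have "\<dots> \<longleftrightarrow>
      (\<exists>s<h. \<exists>k \<in> set (?A s) \<inter> set (?B s). covers_block (lo i) (hi i) s k \<and> ?meets s k)"
  proof -
    have "(\<exists>k \<in> set xs \<inter> set ys. Q k) \<longleftrightarrow> (\<exists>e<length xs. \<exists>e'<length ys. xs ! e = ys ! e' \<and> Q (xs ! e))"
      for xs ys :: "nat list" and Q
      by (metis IntE IntI in_set_conv_nth)
    then show ?thesis by (simp only: len)
  qed
  finally show ?thesis using False by simp
qed (simp add: encode_def)

text \<open>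
  A common point yields a common slab by \<open>common_nearby_block\<close>, spanned by one of the two curves but
  possibly not by the other; this is why both orders of the two codes have to be tried. In the other
  direction, a meeting within a slab is a meeting.
\<close>

lemma meets_iff_code_crosses:
  assumes ij: "i \<in> V" "j \<in> V" "i \<noteq> j" and h: "4 * card V + 1 < 2 ^ h"
  shows "(\<exists>x \<in> {a i..b i} \<inter> {a j..b j}. f i x = f j x) \<longleftrightarrow>
    code_crosses h (encode h i) (encode h j) \<or> code_crosses h (encode h j) (encode h i)" (is "?L \<longleftrightarrow> ?R")
proof
  assume ?L
  then obtain x where x: "x \<in> {a i..b i}" "x \<in> {a j..b j}" "f i x = f j x" by blast
  then have col: "colour i \<noteq> colour j" using disjoint ij by blast
  have "Suc (hi i) < 2 ^ h" "Suc (hi j) < 2 ^ h"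
    using endpoint_atom_le[of "b i"] endpoint_atom_le[of "b j"] h by linarith+
  then obtain s where "s < h"
    and "atom endpoints x div 2 ^ s \<in> set (nearby_blocks (lo i) (hi i) s)"
    and "atom endpoints x div 2 ^ s \<in> set (nearby_blocks (lo j) (hi j) s)"
    and "covers_block (lo i) (hi i) s (atom endpoints x div 2 ^ s) \<or>
      covers_block (lo j) (hi j) s (atom endpoints x div 2 ^ s)"
    using common_nearby_block[of "lo i" "atom endpoints x" "hi i" "lo j" "hi j" h] x ij
    by (metis mem_interval_iff_atom)
  moreover have "x \<in> slab s (atom endpoints x div 2 ^ s)" by (simp add: slab_def)
  ultimately show ?R
    using x col unfolding code_crosses_encode[OF ij(1,2)] code_crosses_encode[OF ij(2,1)]
    by (metis IntI)
next
  assume ?R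
  then show ?L
    using slab_subset_if_covers_block ij
    unfolding code_crosses_encode[OF ij(1,2)] code_crosses_encode[OF ij(2,1)]
    by (metis Int_iff subsetD)
qed

end

section \<open>Counting\<close>

definition decode :: "nat \<Rightarrow> nat \<Rightarrow> (nat \<Rightarrow> vertex_code) \<Rightarrow> nat set set" where
  "decode n h w = {{i, j} | i j. i \<in> {1..n} \<and> j \<in> {1..n} \<and> i \<noteq> j \<and>
     (code_crosses h (w i) (w j) \<or> code_crosses h (w j) (w i))}"

lemma bipartite_x_monotone_graph_decode:
  assumes E: "E \<in> bipartite_x_monotone_graphs n" and h: "4 * n + 1 < 2 ^ h"
  shows "E \<in> decode n h ` ({1..n} \<rightarrow>\<^sub>E vertex_codes n h)"
proof -
  obtain \<gamma> where lab: "labelled_graph {1..n} E"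
    and curves: "\<And>i. i \<in> {1..n} \<Longrightarrow> is_curve (\<gamma> i) \<and> x_monotone (\<gamma> i)"
    and edges: "\<And>i j. i \<in> {1..n} \<Longrightarrow> j \<in> {1..n} \<Longrightarrow> i \<noteq> j \<Longrightarrow> {i, j} \<in> E \<longleftrightarrow> \<gamma> i \<inter> \<gamma> j \<noteq> {}"
    using E unfolding bipartite_x_monotone_graphs_def x_monotone_intersection_graph_def by blast
  obtain A B where AB: "A \<inter> B = {}" "\<forall>e\<in>E. \<exists>a\<in>A. \<exists>b\<in>B. e = {a, b}"
    using E by (auto simp: bipartite_x_monotone_graphs_def bipartite_def)
  have "\<exists>a b f. continuous_on {a..b::real} f \<and> \<gamma> i = (\<lambda>x. (x, f x)) ` {a..b}" if "i \<in> {1..n}" for i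
    using x_monotone_curve_is_graph curves[OF that] by metis
  then obtain a b f where graph: "\<And>i. i \<in> {1..n} \<Longrightarrow>
      continuous_on {a i..b i::real} (f i) \<and> \<gamma> i = (\<lambda>x. (x, f i x)) ` {a i..b i}"
    by metis
  have meet: "\<gamma> i \<inter> \<gamma> j \<noteq> {} \<longleftrightarrow> (\<exists>x \<in> {a i..b i} \<inter> {a j..b j}. f i x = f j x)"
    if "i \<in> {1..n}" "j \<in> {1..n}" for i j
    unfolding conjunct2[OF graph[OF that(1)]] conjunct2[OF graph[OF that(2)]] by force
  interpret two_coloured_graphs "{1..n}" a b f "\<lambda>i. i \<in> A"
  proof
    fix i j x
    assume *: "i \<in> {1..n}" "j \<in> {1..n}" "i \<noteq> j" "(i \<in> A) = (j \<in> A)" "x \<in> {a i..b i}" "x \<in> {a j..b j}"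
    have "{i, j} \<notin> E"
    proof
      assume "{i, j} \<in> E"
      then obtain u v where "u \<in> A" "v \<in> B" "{i, j} = {u, v}" using AB(2) by blast
      then show False using AB(1) *(4) by (auto simp: doubleton_eq_iff)
    qed
    then show "f i x \<noteq> f j x" using edges meet * by blast
  qed (use graph in auto)
  let ?w = "restrict (encode h) {1..n}"
  have adj: "{i, j} \<in> E \<longleftrightarrow> code_crosses h (?w i) (?w j) \<or> code_crosses h (?w j) (?w i)"
    if "i \<in> {1..n}" "j \<in> {1..n}" "i \<noteq> j" for i j
    using meets_iff_code_crosses[OF that, of h] edges[OF that] meet[OF that(1,2)] h that by simp
  have "E \<subseteq> decode n h ?w"
  proof
    fix e assume e: "e \<in> E"
    then have "e \<subseteq> {1..n}" "card e = 2" using lab by (auto simp: labelled_graph_def)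
    then obtain i j where "e = {i, j}" "i \<noteq> j" "i \<in> {1..n}" "j \<in> {1..n}"
      by (auto simp: card_2_iff)
    then show "e \<in> decode n h ?w" using adj[of i j] e unfolding decode_def by blast
  qed
  moreover have "decode n h ?w \<subseteq> E"
    using adj unfolding decode_def by blast
  moreover have "?w \<in> {1..n} \<rightarrow>\<^sub>E vertex_codes n h"
    using encode_in_vertex_codes[of h] by (auto simp: PiE_iff)
  ultimately show ?thesis by blast
qed

lemma card_vertex_codes:
  "card (vertex_codes n h) = 2 * (4 * n + 1) ^ 2 * (n + 1) ^ (12 * h)"
proof -
  have "card (({..<h} \<times> {..<4::nat}) \<rightarrow>\<^sub>E ({..n} \<times> {..n} \<times> {..n})) = ((n + 1) ^ 3) ^ (h * 4)"
    by (subst card_PiE) (auto simp: card_cartesian_product power3_eq_cube algebra_simps)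
  also have "\<dots> = (n + 1) ^ (12 * h)"
    unfolding power_mult[symmetric] by (simp add: mult.commute)
  finally show ?thesis
    by (simp add: vertex_codes_def card_cartesian_product power2_eq_square algebra_simps)
qed

lemma finite_vertex_codes: "finite (vertex_codes n h)"
  unfolding vertex_codes_def by (intro finite_cartesian_product finite_PiE) auto

lemma card_bipartite_x_monotone_graphs_le:
  assumes "4 * n + 1 < 2 ^ h"
  shows "card (bipartite_x_monotone_graphs n) \<le> (2 * (4 * n + 1) ^ 2 * (n + 1) ^ (12 * h)) ^ n"
proof -
  let ?W = "{1..n} \<rightarrow>\<^sub>E vertex_codes n h"
  have "finite ?W" by (intro finite_PiE finite_vertex_codes) auto
  moreover have "bipartite_x_monotone_graphs n \<subseteq> decode n h ` ?W"
    using bipartite_x_monotone_graph_decode[OF _ assms] by blast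
  ultimately have "card (bipartite_x_monotone_graphs n) \<le> card ?W"
    by (rule surj_card_le)
  also have "\<dots> = (2 * (4 * n + 1) ^ 2 * (n + 1) ^ (12 * h)) ^ n"
    by (subst card_PiE) (auto simp: card_vertex_codes)
  finally show ?thesis .
qed

theorem theorem1p4:
  "\<exists>C::real. C > 0 \<and>
     (\<forall>n::nat. n \<ge> 2 \<longrightarrow>
        real (card (bipartite_x_monotone_graphs n)) \<le> 2 powr (C * real n * (log 2 (real n))\<^sup>2))"
  \<comment> \<open>With \<open>h \<le> 5 * L\<close> levels, where \<open>L = log 2 n \<ge> 1\<close>, the exponent \<open>9 + 24 * h\<close> of \<open>n\<close> in the
    number of codes of one curve is at most \<open>129 * L\<close>.\<close>
proof (intro exI[of _ 129] conjI allI impI)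
  fix n :: nat assume n: "n \<ge> 2"
  define L where "L = log 2 (real n)"
  define h where "h = nat \<lceil>4 * L\<rceil>"
  have L: "L \<ge> 1" using n by (simp add: L_def le_log_iff)
  have nL: "2 powr L = real n" using n by (simp add: L_def)
  have h: "4 * L \<le> real h" "real h \<le> 5 * L"
    unfolding h_def using L by linarith+
  have n2: "n + 1 \<le> n ^ 2"
    using n mult_le_mono1[of 2 n n] unfolding power2_eq_square by linarith
  have n4: "4 * n + 1 < n ^ 4"
  proof -
    have "2 ^ 3 * n \<le> n ^ 3 * n" using n by (intro mult_le_mono1 power_mono) auto
    then show ?thesis using n by (simp add: eval_nat_numeral)
  qed
  have "real (n ^ 4) = 2 powr (4 * L)"
    using n by (simp add: nL[symmetric] powr_powr powr_realpow[symmetric] mult.commute del: powr_powr_swap)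
  also have "\<dots> \<le> 2 powr real h" using h by simp
  also have "\<dots> = real (2 ^ h)" by (simp add: powr_realpow)
  finally have "n ^ 4 \<le> 2 ^ h" by (simp only: of_nat_le_iff)
  with n4 have "card (bipartite_x_monotone_graphs n) \<le> (2 * (4 * n + 1) ^ 2 * (n + 1) ^ (12 * h)) ^ n"
    by (intro card_bipartite_x_monotone_graphs_le) simp
  also have "\<dots> \<le> (n * (n ^ 4) ^ 2 * (n ^ 2) ^ (12 * h)) ^ n"
    using n n2 n4 by (intro power_mono mult_mono) auto
  also have "\<dots> = n ^ (n * (9 + 24 * h))"
    by (simp add: power_mult[symmetric] power_add[symmetric] mult.commute flip: power_Suc)
  finally have "real (card (bipartite_x_monotone_graphs n)) \<le> real (n ^ (n * (9 + 24 * h)))"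
    by (simp only: of_nat_le_iff)
  also have "\<dots> = 2 powr (L * (real n * (9 + 24 * real h)))"
    using n by (simp add: nL[symmetric] powr_realpow[symmetric] powr_powr)
  also have "\<dots> \<le> 2 powr (129 * real n * L\<^sup>2)"
  proof -
    have "9 + 24 * real h \<le> 129 * L" using h L by linarith
    then have "L * (real n * (9 + 24 * real h)) \<le> L * (real n * (129 * L))"
      using L by (intro mult_left_mono) auto
    then show ?thesis by (simp add: power2_eq_square algebra_simps)
  qed
  finally show "real (card (bipartite_x_monotone_graphs n)) \<le> 2 powr (129 * real n * (log 2 (real n))\<^sup>2)"
    by (simp add: L_def)
qed simp

end
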